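(* Let $f$, $U$ and the hyperreal field ${}^*\mathbb{R}$ be as in the context. Let $\tilde T=[\langle T_n\rangle]\in{}^*\mathbb{N}$ be an infinite hypernatural number and let $K_0\in{}^*\mathbb{R}$ with $K_0>0$. Consider the problem of maximizing $${}^*\!\!\sum_{t=0}^{\tilde T}{}^*U(C(t))$$ over internal sequences $C:\{0,1,\dots,\tilde T\}\to{}^*\mathbb{R}$ and $K:\{0,1,\dots,\tilde T+1\}\to{}^*\mathbb{R}$ subject to $$C(t)={}^*f(K(t))-K(t+1),\qquad 0\le K(t+1)\le{}^*f(K(t))\qquad(t\in\{0,1,\dots,\tilde T\}),$$ $$K(0)=K_0,\qquad K(\tilde T+1)=0 .$$ Then this problem has a unique optimal solution $\{C(t),K(t)\}_{t=0}^{\tilde T}$.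
   Context: The function $f:\mathbb{R}_+\to\mathbb{R}_+$ is continuous, strictly increasing, (weakly) concave and continuously differentiable, with $f(0)=0$, and there is $\bar x>0$ such that $x\le f(x)\le\bar x$ for $0\le x\le\bar x$ and $f(x)<x$ for $x>\bar x$. The function $U:\mathbb{R}_+\to\mathbb{R}$ is continuous, strictly increasing, strictly concave and continuously differentiable. Hyperreals: ${}^*\mathbb{R}=\mathbb{R}^{\mathbb{N}}/u$, where $u$ is a free ultrafilter on $\mathbb{N}$ (a maximal filter containing the Fréchet filter). Elements are classes $[\langle a_n\rangle]$ of real sequences, and $[\langle a_n\rangle]\ge[\langle b_n\rangle]$ iff $\{n:a_n\ge b_n\}\in u$. ${}^*\mathbb{N}$ is the set of classes of sequences of natural numbers. The functions ${}^*f:{}^*\mathbb{R}_+\to{}^*\mathbb{R}_+$ and ${}^*U:{}^*\mathbb{R}_+\to{}^*\mathbb{R}$ are the natural (componentwise) extensions of $f$ and $U$. The index set $\{0,1,\dots,\tilde T\}$ is $\{t\in{}^*\mathbb{N}:0\le t\le\tilde T\}$. An internal sequence $C$ on it is one represented by a family of real sequences $C_n:\{0,\dots,T_n\}\to\mathbb{R}$, via $C([\langle t_n\rangle])=[\langle C_n(t_n)\rangle]$ (similarly $K$, with $K_n:\{0,\dots,T_n+1\}\to\mathbb{R}$). The hyperfinite sum ${}^*\sum_{t=0}^{\tilde T}{}^*U(C(t))$ is $\bigl[\langle\sum_{t=0}^{T_n}U(C_n(t))\rangle\bigr]$. Optimality is with respect to the order of ${}^*\mathbb{R}$. *)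

theory Defs
  imports "HOL-Analysis.Analysis"
begin

definition strictly_concave_on :: "real set \<Rightarrow> (real \<Rightarrow> real) \<Rightarrow> bool" where
  "strictly_concave_on S g \<longleftrightarrow> convex S \<and>
     (\<forall>x\<in>S. \<forall>y\<in>S. \<forall>l. x \<noteq> y \<and> 0 < l \<and> l < 1 \<longrightarrow>
        (1 - l) * g x + l * g y < g ((1 - l) * x + l * y))"

(* Filters are ordered by reverse inclusion of their sets: v \<le> u means that v contains
   more sets than u, u \<le> cofinite that u contains the Frechet filter, and u \<noteq> bot that
   u is proper. *)
definition free_ultrafilter :: "nat filter \<Rightarrow> bool" where
  "free_ultrafilter u \<longleftrightarrow> u \<noteq> bot \<and> u \<le> cofinite \<and> (\<forall>v. v \<noteq> bot \<and> v \<le> u \<longrightarrow> v = u)"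


section \<open>Ultrapowers of the reals and of the naturals\<close>

(* The ultrapower depends on u and is therefore a set of equivalence classes, not a type.
   Hyperreals are the case 'a = real, hypernaturals the case 'a = nat. *)

type_synonym 'a hyper = "(nat \<Rightarrow> 'a) set"

definition hyper_class :: "nat filter \<Rightarrow> (nat \<Rightarrow> 'a) \<Rightarrow> 'a hyper" where
  "hyper_class u a = {b. eventually (\<lambda>n. a n = b n) u}"

definition hyper_carrier :: "nat filter \<Rightarrow> 'a hyper set" where
  "hyper_carrier u = range (hyper_class u)"

abbreviation hyperreals :: "nat filter \<Rightarrow> real hyper set" where
  "hyperreals \<equiv> hyper_carrier"

abbreviation hypernaturals :: "nat filter \<Rightarrow> nat hyper set" where
  "hypernaturals \<equiv> hyper_carrier"

definition hyper_of :: "nat filter \<Rightarrow> 'a \<Rightarrow> 'a hyper" where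
  "hyper_of u x = hyper_class u (\<lambda>n. x)"

definition hyper_le :: "nat filter \<Rightarrow> 'a::linorder hyper \<Rightarrow> 'a hyper \<Rightarrow> bool" where
  "hyper_le u A B \<longleftrightarrow> (\<exists>a\<in>A. \<exists>b\<in>B. eventually (\<lambda>n. a n \<le> b n) u)"

definition hyper_less :: "nat filter \<Rightarrow> 'a::linorder hyper \<Rightarrow> 'a hyper \<Rightarrow> bool" where
  "hyper_less u A B \<longleftrightarrow> hyper_le u A B \<and> A \<noteq> B"

(* Componentwise extensions of unary and binary functions; the union is over all
   representatives, each of which contributes the same class (lemmas below). *)
definition hyper_map :: "nat filter \<Rightarrow> ('a \<Rightarrow> 'b) \<Rightarrow> 'a hyper \<Rightarrow> 'b hyper" where
  "hyper_map u g A = (\<Union>a\<in>A. hyper_class u (\<lambda>n. g (a n)))"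

definition hyper_map2 ::
  "nat filter \<Rightarrow> ('a \<Rightarrow> 'b \<Rightarrow> 'c) \<Rightarrow> 'a hyper \<Rightarrow> 'b hyper \<Rightarrow> 'c hyper" where
  "hyper_map2 u g A B = (\<Union>a\<in>A. \<Union>b\<in>B. hyper_class u (\<lambda>n. g (a n) (b n)))"

definition infinite_hypernatural :: "nat filter \<Rightarrow> nat hyper \<Rightarrow> bool" where
  "infinite_hypernatural u T \<longleftrightarrow> T \<in> hypernaturals u \<and> (\<forall>m::nat. hyper_less u (hyper_of u m) T)"

lemma hyper_class_self [simp]: "a \<in> hyper_class u a"
  by (simp add: hyper_class_def)

lemma hyper_class_eq_iff:
  "hyper_class u a = hyper_class u b \<longleftrightarrow> eventually (\<lambda>n. a n = b n) u"
proof
  assume "hyper_class u a = hyper_class u b"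
  then have "b \<in> hyper_class u a" by simp
  then show "eventually (\<lambda>n. a n = b n) u" by (simp add: hyper_class_def)
next
  assume ab: "eventually (\<lambda>n. a n = b n) u"
  have "eventually (\<lambda>n. a n = c n) u \<longleftrightarrow> eventually (\<lambda>n. b n = c n) u" for c
    by (rule eventually_cong[OF ab]) simp
  then show "hyper_class u a = hyper_class u b"
    by (simp add: hyper_class_def)
qed

lemma hyper_le_class:
  "hyper_le u (hyper_class u a) (hyper_class u b) \<longleftrightarrow> eventually (\<lambda>n. a n \<le> b n) u"
proof
  assume "hyper_le u (hyper_class u a) (hyper_class u b)"
  then obtain a' b' where "eventually (\<lambda>n. a n = a' n) u" "eventually (\<lambda>n. b n = b' n) u"
    "eventually (\<lambda>n. a' n \<le> b' n) u"
    by (auto simp: hyper_le_def hyper_class_def)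
  then show "eventually (\<lambda>n. a n \<le> b n) u"
    by eventually_elim simp
next
  assume "eventually (\<lambda>n. a n \<le> b n) u"
  then show "hyper_le u (hyper_class u a) (hyper_class u b)"
    unfolding hyper_le_def by (meson hyper_class_self)
qed

lemma hyper_map_class: "hyper_map u g (hyper_class u a) = hyper_class u (\<lambda>n. g (a n))"
proof -
  have "hyper_class u (\<lambda>n. g (a' n)) = hyper_class u (\<lambda>n. g (a n))"
    if "a' \<in> hyper_class u a" for a'
    using that unfolding hyper_class_eq_iff
    by (auto simp: hyper_class_def elim: eventually_mono)
  then show ?thesis
    unfolding hyper_map_def using hyper_class_self[of a u] by blast
qed

lemma hyper_map2_class:
  "hyper_map2 u g (hyper_class u a) (hyper_class u b) = hyper_class u (\<lambda>n. g (a n) (b n))"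
proof -
  have "hyper_class u (\<lambda>n. g (a' n) (b' n)) = hyper_class u (\<lambda>n. g (a n) (b n))"
    if "a' \<in> hyper_class u a" "b' \<in> hyper_class u b" for a' b'
  proof -
    have "eventually (\<lambda>n. a n = a' n) u" "eventually (\<lambda>n. b n = b' n) u"
      using that by (simp_all add: hyper_class_def)
    then show ?thesis
      unfolding hyper_class_eq_iff by eventually_elim simp
  qed
  then show ?thesis
    unfolding hyper_map2_def using hyper_class_self[of a u] hyper_class_self[of b u] by blast
qed


section \<open>Internal sequences and hyperfinite sums\<close>

(* The index set from 0 to T. *)
definition hyper_seg :: "nat filter \<Rightarrow> nat hyper \<Rightarrow> nat hyper set" where
  "hyper_seg u T = {t \<in> hypernaturals u. hyper_le u t T}"

(* c n is the n-th component. If the class of k is at most that of T, then k n \<le> T n for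
   u-almost all n, so only the values of c n at 0, ..., T n matter. *)
definition represents ::
  "nat filter \<Rightarrow> nat hyper \<Rightarrow> (nat hyper \<Rightarrow> real hyper) \<Rightarrow> (nat \<Rightarrow> nat \<Rightarrow> real) \<Rightarrow> bool" where
  "represents u T C c \<longleftrightarrow>
     (\<forall>k. hyper_class u k \<in> hyper_seg u T \<longrightarrow>
        C (hyper_class u k) = hyper_class u (\<lambda>n. c n (k n)))"

(* Extensionality makes equality of functions mean equality on the index set. *)
definition internal_sequence ::
  "nat filter \<Rightarrow> nat hyper \<Rightarrow> (nat hyper \<Rightarrow> real hyper) \<Rightarrow> bool" where
  "internal_sequence u T C \<longleftrightarrow> C \<in> extensional (hyper_seg u T) \<and> (\<exists>c. represents u T C c)"

definition hyper_sum :: "nat filter \<Rightarrow> nat hyper \<Rightarrow> (nat hyper \<Rightarrow> real hyper) \<Rightarrow> real hyper" where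
  "hyper_sum u T F =
     (\<Union>T'\<in>T. \<Union>c\<in>{c. represents u T F c}. hyper_class u (\<lambda>n. \<Sum>t=0..T' n. c n t))"

lemma represents_unique:
  assumes "represents u (hyper_class u T) F c" "represents u (hyper_class u T) F d"
  shows "eventually (\<lambda>n. \<forall>t\<le>T n. c n t = d n t) u"
proof -
  define k where "k n = (if \<forall>t\<le>T n. c n t = d n t then 0
                         else SOME t. t \<le> T n \<and> c n t \<noteq> d n t)" for n
  have k: "k n \<le> T n \<and> c n (k n) \<noteq> d n (k n)" if "\<not> (\<forall>t\<le>T n. c n t = d n t)" for n
  proof -
    have "\<exists>t. t \<le> T n \<and> c n t \<noteq> d n t" using that by blast
    then show ?thesis using that unfolding k_def by (simp only: if_False) (rule someI_ex)
  qed
  have "k n \<le> T n" for n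
    using k[of n] by (cases "\<forall>t\<le>T n. c n t = d n t") (auto simp: k_def)
  then have "hyper_class u k \<in> hyper_seg u (hyper_class u T)"
    by (simp add: hyper_seg_def hyper_carrier_def hyper_le_class)
  then have "hyper_class u (\<lambda>n. c n (k n)) = hyper_class u (\<lambda>n. d n (k n))"
    using assms by (metis represents_def)
  then have "eventually (\<lambda>n. c n (k n) = d n (k n)) u"
    by (simp add: hyper_class_eq_iff)
  then show ?thesis
    by (rule eventually_mono) (use k in blast)
qed

lemma hyper_sum_class:
  assumes "represents u (hyper_class u T) F c"
  shows "hyper_sum u (hyper_class u T) F = hyper_class u (\<lambda>n. \<Sum>t=0..T n. c n t)"
proof -
  have "hyper_class u (\<lambda>n. \<Sum>t=0..T' n. d n t) = hyper_class u (\<lambda>n. \<Sum>t=0..T n. c n t)"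
    if "T' \<in> hyper_class u T" "represents u (hyper_class u T) F d" for T' d
  proof -
    have "eventually (\<lambda>n. T n = T' n) u"
      using that(1) by (simp add: hyper_class_def)
    with represents_unique[OF that(2) assms] show ?thesis
      unfolding hyper_class_eq_iff by eventually_elim (auto intro: sum.cong)
  qed
  then show ?thesis
    unfolding hyper_sum_def using assms hyper_class_self[of T u] by blast
qed

lemma hyper_sum_map_class:
  assumes "represents u (hyper_class u T) C c"
  shows "hyper_sum u (hyper_class u T) (\<lambda>t. hyper_map u U (C t))
           = hyper_class u (\<lambda>n. \<Sum>t=0..T n. U (c n t))"
  by (rule hyper_sum_class) (use assms in \<open>simp add: represents_def hyper_map_class\<close>)


section \<open>The planning problem\<close>

definition feasible_plan ::
  "nat filter \<Rightarrow> (real \<Rightarrow> real) \<Rightarrow> nat hyper \<Rightarrow> real hyper \<Rightarrow>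
     (nat hyper \<Rightarrow> real hyper) \<Rightarrow> (nat hyper \<Rightarrow> real hyper) \<Rightarrow> bool" where
  "feasible_plan u f T K\<^sub>0 C K \<longleftrightarrow>
     internal_sequence u T C \<and>
     internal_sequence u (hyper_map u Suc T) K \<and>
     (\<forall>t\<in>hyper_seg u T.
        C t = hyper_map2 u (-) (hyper_map u f (K t)) (K (hyper_map u Suc t)) \<and>
        hyper_le u (hyper_of u 0) (K (hyper_map u Suc t)) \<and>
        hyper_le u (K (hyper_map u Suc t)) (hyper_map u f (K t))) \<and>
     K (hyper_of u 0) = K\<^sub>0 \<and>
     K (hyper_map u Suc T) = hyper_of u 0"

definition total_utility ::
  "nat filter \<Rightarrow> (real \<Rightarrow> real) \<Rightarrow> nat hyper \<Rightarrow> (nat hyper \<Rightarrow> real hyper) \<Rightarrow> real hyper" where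
  "total_utility u U T C = hyper_sum u T (\<lambda>t. hyper_map u U (C t))"

definition optimal_plan ::
  "nat filter \<Rightarrow> (real \<Rightarrow> real) \<Rightarrow> (real \<Rightarrow> real) \<Rightarrow> nat hyper \<Rightarrow> real hyper \<Rightarrow>
     (nat hyper \<Rightarrow> real hyper) \<Rightarrow> (nat hyper \<Rightarrow> real hyper) \<Rightarrow> bool" where
  "optimal_plan u f U T K\<^sub>0 C K \<longleftrightarrow>
     feasible_plan u f T K\<^sub>0 C K \<and>
     (\<forall>C' K'. feasible_plan u f T K\<^sub>0 C' K' \<longrightarrow>
        hyper_le u (total_utility u U T C') (total_utility u U T C))"

end

theory Submission
  imports Defs
begin

(* For a finite horizon, the admissible capital paths form a compact set on which total
   utility is continuous, and averaging two optimal paths shows that they coincide. Optimal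
   paths for the components of T and K_0 then represent the optimal internal path.
   An internal family of conditions holds at every hypernatural up to T iff almost every
   component satisfies it at all indices up to T n, since otherwise the violating indices would
   define a hypernatural at which it fails. *)

section \<open>Finite horizon\<close>

text \<open>Values of \<open>k\<close> beyond \<open>Suc N\<close> are unconstrained, so uniqueness
  of paths can only be claimed up to \<open>Suc N\<close>.\<close>

definition capital_path :: "(real \<Rightarrow> real) \<Rightarrow> nat \<Rightarrow> real \<Rightarrow> (nat \<Rightarrow> real) \<Rightarrow> bool" where
  "capital_path f N x k \<longleftrightarrow>
     k 0 = x \<and> k (Suc N) = 0 \<and> (\<forall>t\<le>N. 0 \<le> k (Suc t) \<and> k (Suc t) \<le> f (k t))"

definition consumption :: "(real \<Rightarrow> real) \<Rightarrow> (nat \<Rightarrow> real) \<Rightarrow> nat \<Rightarrow> real" where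
  "consumption f k t = f (k t) - k (Suc t)"

definition path_utility ::
  "(real \<Rightarrow> real) \<Rightarrow> (real \<Rightarrow> real) \<Rightarrow> nat \<Rightarrow> (nat \<Rightarrow> real) \<Rightarrow> real" where
  "path_utility f U N k = (\<Sum>t=0..N. U (consumption f k t))"

definition optimal_path ::
  "(real \<Rightarrow> real) \<Rightarrow> (real \<Rightarrow> real) \<Rightarrow> nat \<Rightarrow> real \<Rightarrow> (nat \<Rightarrow> real) \<Rightarrow> bool" where
  "optimal_path f U N x k \<longleftrightarrow> capital_path f N x k \<and>
     (\<forall>k'. capital_path f N x k' \<longrightarrow> path_utility f U N k' \<le> path_utility f U N k)"

lemma capital_path_nonneg:
  assumes "capital_path f N x k" "0 \<le> x" "t \<le> Suc N"
  shows "0 \<le> k t"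
  using assms by (cases t) (auto simp: capital_path_def)

lemma consumption_nonneg:
  assumes "capital_path f N x k" "t \<le> N"
  shows "0 \<le> consumption f k t"
  using assms by (auto simp: capital_path_def consumption_def)

text \<open>Saving the whole output in every period gives the largest capital stock, by monotonicity
  of \<open>f\<close>. The bound is the same for all admissible paths, which puts them into one
  compact box.\<close>

lemma capital_path_le_funpow:
  assumes "capital_path f N x k" "0 \<le> x" "mono_on {0..} f" "t \<le> Suc N"
  shows "k t \<le> (f ^^ t) x"
  using assms(4)
proof (induction t)
  case 0
  then show ?case using assms by (simp add: capital_path_def)
next
  case (Suc t)
  have "k (Suc t) \<le> f (k t)" using assms Suc.prems by (simp add: capital_path_def)
  also have "\<dots> \<le> f ((f ^^ t) x)"
    using Suc capital_path_nonneg[OF assms(1,2), of t]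
    by (intro mono_onD[OF assms(3)]) auto
  finally show ?case by simp
qed

section \<open>Existence of an optimal path for a finite horizon\<close>

text \<open>Tychonoff: the set is a product of compact intervals, and the topology on
  \<open>nat \<Rightarrow> real\<close> is the product topology.\<close>

lemma compact_bounded_functions: "compact {k::nat \<Rightarrow> real. \<forall>t. k t \<in> {0..M t}}"
proof -
  have "compactin (product_topology (\<lambda>_::nat. euclidean) UNIV) (PiE UNIV (\<lambda>t. {0..M t::real}))"
    by (subst compactin_PiE) auto
  then have "compact (PiE UNIV (\<lambda>t. {0..M t::real}))"
    by (simp add: euclidean_product_topology)
  moreover have "PiE UNIV (\<lambda>t. {0..M t}) = {k::nat \<Rightarrow> real. \<forall>t. k t \<in> {0..M t}}"
    by (auto simp: PiE_def Pi_def)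
  ultimately show ?thesis by simp
qed

text \<open>Clamping the argument at 0 extends a function continuous on the half-line continuously
  to all reals, so that constraints and utility can be studied on the whole function space.\<close>

lemma continuous_on_comp_max:
  fixes g :: "real \<Rightarrow> real" and h :: "'a::topological_space \<Rightarrow> real"
  assumes "continuous_on {0..} g" "continuous_on UNIV h"
  shows "continuous_on UNIV (\<lambda>x. g (max 0 (h x)))"
  by (rule continuous_on_compose2[OF assms(1)]) (auto intro!: continuous_intros assms)

lemma optimal_path_exists:
  assumes x: "0 \<le> x" and f: "f \<in> {0..} \<rightarrow> {0..}" "continuous_on {0..} f" "mono_on {0..} f"
    and U: "continuous_on {0..} U"
  shows "\<exists>k. optimal_path f U N x k"
proof -
  define g h where "g y = f (max 0 y)" and "h y = U (max 0 y)" for y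
  define S where "S = {k. \<forall>t. k t \<in> {0..(f ^^ t) x}} \<inter>
    {k. k 0 = x \<and> k (Suc N) = 0 \<and> (\<forall>t. t \<le> N \<longrightarrow> k (Suc t) \<le> g (k t))}"
  define V where "V k = (\<Sum>t=0..N. h (g (k t) - k (Suc t)))" for k :: "nat \<Rightarrow> real"
  have coord: "continuous_on UNIV (\<lambda>k::nat \<Rightarrow> real. k t)" for t
    by (rule continuous_on_product_coordinates)
  have g: "continuous_on UNIV (\<lambda>k::nat \<Rightarrow> real. g (k t))" for t
    unfolding g_def by (rule continuous_on_comp_max[OF f(2) coord])
  have V: "continuous_on UNIV V"
    unfolding V_def h_def
    by (intro continuous_on_sum continuous_on_comp_max[OF U] continuous_on_diff g coord)
  \<comment> \<open>The premise \<open>t \<le> N\<close> does not depend on \<open>k\<close> and so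
    defines an open set, as \<open>closed_Collect_imp\<close> requires.\<close>
  have "closed {k::nat \<Rightarrow> real. k 0 = x \<and> k (Suc N) = 0 \<and> (\<forall>t. t \<le> N \<longrightarrow> k (Suc t) \<le> g (k t))}"
    by (intro closed_Collect_conj closed_Collect_all closed_Collect_imp closed_Collect_eq
        closed_Collect_le coord g continuous_on_const open_Collect_const)
  then have S: "compact S"
    unfolding S_def by (intro compact_Int_closed compact_bounded_functions)
  have pow: "0 \<le> (f ^^ t) x" for t
    using x f(1) by (induction t) auto
  \<comment> \<open>On \<open>S\<close> the clamping is invisible: capital and consumption are
    nonnegative there, so \<open>V\<close> is the true utility.\<close>
  have S_path: "capital_path f N x k \<and> path_utility f U N k = V k" if "k \<in> S" for k
  proof -
    have path: "capital_path f N x k"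
      using that by (auto simp: S_def capital_path_def g_def)
    have "h (g (k t) - k (Suc t)) = U (consumption f k t)" if "t \<le> N" for t
      using capital_path_nonneg[OF path x, of t] consumption_nonneg[OF path that] that
      by (simp add: h_def g_def consumption_def)
    then have "path_utility f U N k = V k"
      by (auto simp: path_utility_def V_def intro!: sum.cong)
    then show ?thesis using path by simp
  qed
  have path_S: "\<exists>k'\<in>S. path_utility f U N k' = path_utility f U N k"
    if path: "capital_path f N x k" for k
  proof
    \<comment> \<open>An arbitrary path may leave the box after the horizon, so it is cut to 0
      there; 0 lies in every interval by \<open>pow\<close>. Cutting already after \<open>N\<close>
      changes nothing at \<open>Suc N\<close>, where capital is 0 anyway.\<close>
    let ?k = "\<lambda>t. if t \<le> N then k t else 0"
    have eq: "?k (Suc t) = k (Suc t)" if "t \<le> N" for t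
      using path that by (auto simp: capital_path_def not_less_eq_eq le_antisym)
    have "?k (Suc t) \<le> g (?k t)" if "t \<le> N" for t
      using path that capital_path_nonneg[OF path x, of t] eq[OF that]
      by (simp add: capital_path_def g_def)
    then show "?k \<in> S"
      using path capital_path_nonneg[OF path x] capital_path_le_funpow[OF path x f(3)] pow
      by (auto simp: S_def capital_path_def)
    show "path_utility f U N ?k = path_utility f U N k"
      unfolding path_utility_def consumption_def
      by (rule sum.cong) (use eq in auto)
  qed
  \<comment> \<open>Consuming all output at once and saving nothing is always admissible.\<close>
  have "capital_path f N x (\<lambda>t. if t = 0 then x else 0)"
    using f(1) x by (auto simp: capital_path_def)
  then have "S \<noteq> {}" using path_S by blast
  then obtain k where k: "k \<in> S" "\<And>k'. k' \<in> S \<Longrightarrow> V k' \<le> V k"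
    using continuous_attains_sup[OF S] continuous_on_subset[OF V] by (metis subset_UNIV)
  have "path_utility f U N k' \<le> path_utility f U N k" if "capital_path f N x k'" for k'
    using path_S[OF that] S_path k by metis
  then show ?thesis using S_path k(1) unfolding optimal_path_def by blast
qed

section \<open>Uniqueness of the optimal path for a finite horizon\<close>

text \<open>By concavity of \<open>f\<close> the average \<open>m\<close> of the two paths is
  admissible and consumes at least the average amount. If the consumptions differed in some period,
  strict concavity of \<open>U\<close> would make \<open>m\<close> better than \<open>k\<close>. The
  path \<open>k'\<close> need only do as well as \<open>k\<close>, which is what a comparison of
  hyperreal utilities yields in a component.\<close>

lemma optimal_path_unique:
  assumes x: "0 \<le> x" and f: "concave_on {0..} f"
    and U: "strict_mono_on {0..} U" "strictly_concave_on {0..} U"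
    and k: "optimal_path f U N x k"
    and k': "capital_path f N x k'" "path_utility f U N k \<le> path_utility f U N k'"
    and "t \<le> Suc N"
  shows "k' t = k t"
proof -
  have kp: "capital_path f N x k" using k by (simp add: optimal_path_def)
  define m where "m t = (k t + k' t) / 2" for t
  have fm: "(f (k t) + f (k' t)) / 2 \<le> f (m t)" if "t \<le> N" for t
    using concave_onD[OF f, of "1/2" "k t" "k' t"] that
      capital_path_nonneg[OF kp x, of t] capital_path_nonneg[OF k'(1) x, of t]
    by (simp add: m_def field_simps)
  have mp: "capital_path f N x m"
    unfolding capital_path_def
  proof (intro conjI allI impI)
    show "m 0 = x" "m (Suc N) = 0" using kp k'(1) by (auto simp: capital_path_def m_def)
    fix t assume t: "t \<le> N"
    show "0 \<le> m (Suc t)"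
      using kp k'(1) t by (simp add: capital_path_def m_def)
    show "m (Suc t) \<le> f (m t)"
    proof -
      have "k (Suc t) \<le> f (k t)" "k' (Suc t) \<le> f (k' t)"
        using kp k'(1) t by (auto simp: capital_path_def)
      then show ?thesis using fm[OF t] by (simp add: m_def)
    qed
  qed
  let ?c = "consumption f k" and ?c' = "consumption f k'" and ?d = "consumption f m"
  have avg: "U ((?c t + ?c' t) / 2) \<le> U (?d t)" if "t \<le> N" for t
  proof -
    have "(?c t + ?c' t) / 2 \<le> ?d t"
      using fm[OF that] by (simp add: consumption_def m_def field_simps)
    moreover have "0 \<le> (?c t + ?c' t) / 2"
      using consumption_nonneg[OF kp that] consumption_nonneg[OF k'(1) that] by simp
    ultimately show ?thesis
      using strict_mono_on_leD[OF U(1)] by simp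
  qed
  have less: "(U (?c t) + U (?c' t)) / 2 < U (?d t)" if "t \<le> N" "?c t \<noteq> ?c' t" for t
  proof -
    have "(1 - 1/2) * U (?c t) + 1/2 * U (?c' t) < U ((1 - 1/2) * ?c t + 1/2 * ?c' t)"
      using U(2) consumption_nonneg[OF kp that(1)] consumption_nonneg[OF k'(1) that(1)] that(2)
      unfolding strictly_concave_on_def by (smt (verit) atLeast_iff half_gt_zero field_sum_of_halves)
    then show ?thesis using avg[OF that(1)] by (simp add: field_simps)
  qed
  have le: "(U (?c t) + U (?c' t)) / 2 \<le> U (?d t)" if "t \<le> N" for t
    using less[OF that] avg[OF that] by (cases "?c t = ?c' t") auto
  have c_eq: "?c t = ?c' t" if t: "t \<le> N" for t
  proof (rule ccontr)
    assume "?c t \<noteq> ?c' t"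
    then have "(\<Sum>t=0..N. (U (?c t) + U (?c' t)) / 2) < path_utility f U N m"
      unfolding path_utility_def
      by (intro sum_strict_mono_ex1 bexI[of _ t]) (use le less t in auto)
    moreover have "(\<Sum>t=0..N. (U (?c t) + U (?c' t)) / 2)
        = (path_utility f U N k + path_utility f U N k') / 2"
      by (simp add: path_utility_def sum.distrib flip: sum_divide_distrib)
    moreover have "path_utility f U N m \<le> path_utility f U N k"
      using k mp by (simp add: optimal_path_def)
    ultimately show False using k'(2) by simp
  qed
  \<comment> \<open>Initial capital and consumption determine the path by the recursion
    \<open>k (Suc t) = f (k t) - consumption f k t\<close>.\<close>
  show ?thesis
    using \<open>t \<le> Suc N\<close>
  proof (induction t)
    case 0
    then show ?case using kp k'(1) by (simp add: capital_path_def)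
  next
    case (Suc t)
    then show ?case using c_eq[of t] by (simp add: consumption_def)
  qed
qed


section \<open>Internal sequences and their components\<close>

lemma eventually_all_le:
  assumes "\<And>k. (\<And>n. k n \<le> N n) \<Longrightarrow> eventually (\<lambda>n. P n (k n)) u"
  shows "eventually (\<lambda>n. \<forall>t\<le>N n. P n (t::nat)) u"
proof -
  \<comment> \<open>Such an \<open>s\<close> is a counterexample to \<open>P n\<close> if there is
    one, and any index up to \<open>N n\<close> otherwise.\<close>
  have "\<exists>s\<le>N n. P n s \<longrightarrow> (\<forall>t\<le>N n. P n t)" for n
    by (cases "\<forall>t\<le>N n. P n t") auto
  then obtain k where k: "\<And>n. k n \<le> N n" "\<And>n. P n (k n) \<longrightarrow> (\<forall>t\<le>N n. P n t)"
    by metis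
  show ?thesis
    using assms[of k, OF k(1)] by (rule eventually_mono) (use k(2) in blast)
qed

lemma hyper_class_in_seg:
  "hyper_class u k \<in> hyper_seg u (hyper_class u N) \<longleftrightarrow> eventually (\<lambda>n. k n \<le> N n) u"
  by (simp add: hyper_seg_def hyper_carrier_def hyper_le_class)

lemma ball_hyper_seg:
  "(\<forall>t\<in>hyper_seg u (hyper_class u N). Q t) \<longleftrightarrow>
     (\<forall>k. eventually (\<lambda>n. k n \<le> N n) u \<longrightarrow> Q (hyper_class u k))"
  by (auto simp: hyper_class_in_seg hyper_seg_def hyper_carrier_def hyper_le_class)

text \<open>The case of Los's theorem for a universal quantifier bounded by a hypernatural.\<close>

lemma eventually_all_le_iff:
  "(\<forall>k. eventually (\<lambda>n. k n \<le> N n) u \<longrightarrow> eventually (\<lambda>n. P n (k n)) u) \<longleftrightarrow>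
     eventually (\<lambda>n. \<forall>t\<le>N n. P n (t::nat)) u" (is "?L \<longleftrightarrow> ?R")
proof
  assume ?L
  then show ?R by (intro eventually_all_le) simp
next
  assume ?R
  show ?L
  proof (intro allI impI)
    fix k assume "eventually (\<lambda>n. k n \<le> N n) u"
    with \<open>?R\<close> show "eventually (\<lambda>n. P n (k n)) u"
      by eventually_elim simp
  qed
qed

text \<open>An index \<open>t\<close> is a class, so \<open>SOME\<close> picks a representative to
  evaluate \<open>c\<close> at; the value does not depend on the choice. Restriction to the segment
  makes the function extensional.\<close>

definition internal_of ::
  "nat filter \<Rightarrow> nat hyper \<Rightarrow> (nat \<Rightarrow> nat \<Rightarrow> real) \<Rightarrow> nat hyper \<Rightarrow> real hyper" where
  "internal_of u T c =
     restrict (\<lambda>t. hyper_class u (\<lambda>n. c n ((SOME k. t = hyper_class u k) n))) (hyper_seg u T)"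

lemma represents_internal_of: "represents u T (internal_of u T c) c"
  unfolding represents_def
proof (intro allI impI)
  fix k assume k: "hyper_class u k \<in> hyper_seg u T"
  define k' where "k' = (SOME k'. hyper_class u k = hyper_class u k')"
  have "hyper_class u k = hyper_class u k'"
    unfolding k'_def using someI[of "\<lambda>k'. hyper_class u k = hyper_class u k'", OF refl] .
  then have "eventually (\<lambda>n. k n = k' n) u" by (simp add: hyper_class_eq_iff)
  then have "hyper_class u (\<lambda>n. c n (k' n)) = hyper_class u (\<lambda>n. c n (k n))"
    unfolding hyper_class_eq_iff by eventually_elim simp
  then show "internal_of u T c (hyper_class u k) = hyper_class u (\<lambda>n. c n (k n))"
    using k by (simp add: internal_of_def k'_def)
qed

lemma internal_sequence_internal_of: "internal_sequence u T (internal_of u T c)"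
  using represents_internal_of unfolding internal_sequence_def internal_of_def by blast

text \<open>Turns agreement of almost all components up to the horizon into equality of functions;
  outside the segment extensionality decides.\<close>

lemma internal_of_eqI:
  assumes C: "internal_sequence u (hyper_class u N) C" "represents u (hyper_class u N) C c"
    and eq: "eventually (\<lambda>n. \<forall>t\<le>N n. c n t = d n t) u"
  shows "C = internal_of u (hyper_class u N) d"
proof (rule extensionalityI)
  show "C \<in> extensional (hyper_seg u (hyper_class u N))"
    using C(1) by (simp add: internal_sequence_def)
  show "internal_of u (hyper_class u N) d \<in> extensional (hyper_seg u (hyper_class u N))"
    by (simp add: internal_of_def)
  fix t assume t: "t \<in> hyper_seg u (hyper_class u N)"
  then obtain k where k: "t = hyper_class u k" by (auto simp: hyper_seg_def hyper_carrier_def)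
  have "eventually (\<lambda>n. k n \<le> N n) u" using t by (simp add: k hyper_class_in_seg)
  then have "eventually (\<lambda>n. c n (k n) = d n (k n)) u"
    using eq by eventually_elim simp
  then show "C t = internal_of u (hyper_class u N) d t"
    using C(2) represents_internal_of[of u "hyper_class u N" d] t
    by (simp add: k represents_def hyper_class_eq_iff)
qed

section \<open>Transfer between plans and paths in the components\<close>

text \<open>At a fixed hypernatural each constraint says that it holds in almost every component;
  \<open>eventually_all_le_iff\<close> then moves the quantifier over periods inside.\<close>

lemma feasible_plan_iff:
  fixes u :: "nat filter" and N :: "nat \<Rightarrow> nat" and x :: "nat \<Rightarrow> real"
  defines "T \<equiv> hyper_class u N"
  assumes C: "internal_sequence u T C" "represents u T C c"
    and K: "internal_sequence u (hyper_map u Suc T) K" "represents u (hyper_map u Suc T) K k"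
  shows "feasible_plan u f T (hyper_class u x) C K \<longleftrightarrow>
    eventually (\<lambda>n. capital_path f (N n) (x n) (k n) \<and>
      (\<forall>t\<le>N n. c n t = consumption f (k n) t)) u"
proof -
  \<comment> \<open>Capital has one index more than consumption, hence the bound
    \<open>Suc (N n)\<close>.\<close>
  have Kat: "K (hyper_class u s) = hyper_class u (\<lambda>n. k n (s n))"
    if "eventually (\<lambda>n. s n \<le> Suc (N n)) u" for s
    using K(2) that by (simp add: represents_def T_def hyper_map_class hyper_class_in_seg)
  have K0: "K (hyper_of u 0) = hyper_class u (\<lambda>n. k n 0)"
    unfolding hyper_of_def by (rule Kat) simp
  have KT: "K (hyper_map u Suc T) = hyper_class u (\<lambda>n. k n (Suc (N n)))"
    unfolding T_def hyper_map_class by (rule Kat) simp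
  have step: "(C (hyper_class u s) = hyper_map2 u (-) (hyper_map u f (K (hyper_class u s)))
                (K (hyper_map u Suc (hyper_class u s))) \<and>
        hyper_le u (hyper_of u 0) (K (hyper_map u Suc (hyper_class u s))) \<and>
        hyper_le u (K (hyper_map u Suc (hyper_class u s))) (hyper_map u f (K (hyper_class u s)))) \<longleftrightarrow>
      eventually (\<lambda>n. c n (s n) = consumption f (k n) (s n) \<and>
        0 \<le> k n (Suc (s n)) \<and> k n (Suc (s n)) \<le> f (k n (s n))) u"
    if s: "eventually (\<lambda>n. s n \<le> N n) u" for s
  proof -
    have "C (hyper_class u s) = hyper_class u (\<lambda>n. c n (s n))"
      using C(2) s by (simp add: represents_def T_def hyper_class_in_seg)
    moreover have "K (hyper_class u s) = hyper_class u (\<lambda>n. k n (s n))"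
      by (rule Kat) (use s in \<open>auto elim: eventually_mono\<close>)
    moreover have "K (hyper_map u Suc (hyper_class u s)) = hyper_class u (\<lambda>n. k n (Suc (s n)))"
      unfolding hyper_map_class by (rule Kat) (use s in simp)
    ultimately show ?thesis
      by (simp add: hyper_map_class hyper_map2_class hyper_of_def hyper_le_class
          hyper_class_eq_iff consumption_def eventually_conj_iff)
  qed
  have "feasible_plan u f T (hyper_class u x) C K \<longleftrightarrow>
      (\<forall>s. eventually (\<lambda>n. s n \<le> N n) u \<longrightarrow>
        eventually (\<lambda>n. c n (s n) = consumption f (k n) (s n) \<and>
          0 \<le> k n (Suc (s n)) \<and> k n (Suc (s n)) \<le> f (k n (s n))) u) \<and>
      eventually (\<lambda>n. k n 0 = x n) u \<and> eventually (\<lambda>n. k n (Suc (N n)) = 0) u"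
    unfolding feasible_plan_def K0 KT using C(1) K(1) step
    unfolding T_def ball_hyper_seg
    by (simp add: hyper_class_eq_iff hyper_of_def)
  also have "\<dots> \<longleftrightarrow> eventually (\<lambda>n. capital_path f (N n) (x n) (k n) \<and>
      (\<forall>t\<le>N n. c n t = consumption f (k n) t)) u"
    \<comment> \<open>\<open>P\<close> collects the constraints of one period; the two boundary
      conditions are joined to it by closure of the filter under intersection.\<close>
    unfolding eventually_all_le_iff[where P = "\<lambda>n t. c n t = consumption f (k n) t \<and>
      0 \<le> k n (Suc t) \<and> k n (Suc t) \<le> f (k n t)"] eventually_conj_iff[symmetric]
    by (rule arg_cong2[where f = eventually]) (auto simp: capital_path_def fun_eq_iff)
  finally show ?thesis .
qed

lemma total_utility_consumption:
  assumes "represents u (hyper_class u N) C c"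
    and "eventually (\<lambda>n. \<forall>t\<le>N n. c n t = consumption f (k n) t) u"
  shows "total_utility u U (hyper_class u N) C = hyper_class u (\<lambda>n. path_utility f U (N n) (k n))"
  unfolding total_utility_def hyper_sum_map_class[OF assms(1)] hyper_class_eq_iff path_utility_def
  using assms(2) by eventually_elim simp

lemma feasible_planE:
  assumes "feasible_plan u f (hyper_class u N) (hyper_class u x) C K"
  obtains c k where "represents u (hyper_class u N) C c"
    and "represents u (hyper_class u (\<lambda>n. Suc (N n))) K k"
    and "eventually (\<lambda>n. capital_path f (N n) (x n) (k n)) u"
    and "eventually (\<lambda>n. \<forall>t\<le>N n. c n t = consumption f (k n) t) u"
proof -
  have int: "internal_sequence u (hyper_class u N) C"
    "internal_sequence u (hyper_map u Suc (hyper_class u N)) K"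
    using assms by (auto simp: feasible_plan_def)
  then obtain c k where rep: "represents u (hyper_class u N) C c"
    "represents u (hyper_map u Suc (hyper_class u N)) K k"
    by (auto simp: internal_sequence_def)
  show ?thesis
    using that rep feasible_plan_iff[OF int(1) rep(1) int(2) rep(2), of f x] assms
    by (simp add: hyper_map_class eventually_conj_iff)
qed

section \<open>Existence and uniqueness of the optimal internal plan\<close>

text \<open>The optimal plan is the one represented by the paths \<open>\<kappa> n\<close>. Any
  other feasible plan is admissible in almost every component, where its utility is at most that of
  \<open>\<kappa> n\<close>.\<close>

lemma optimal_plan_unique_existence:
  fixes N :: "nat \<Rightarrow> nat" and x :: "nat \<Rightarrow> real"
  assumes opt: "\<And>n. optimal_path f U (N n) (x n) (\<kappa> n)"
    and uniq: "\<And>n k t. \<lbrakk>capital_path f (N n) (x n) k;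
      path_utility f U (N n) (\<kappa> n) \<le> path_utility f U (N n) k; t \<le> Suc (N n)\<rbrakk> \<Longrightarrow> k t = \<kappa> n t"
  shows "\<exists>!(C, K). optimal_plan u f U (hyper_class u N) (hyper_class u x) C K"
proof -
  let ?T = "hyper_class u N" and ?T' = "hyper_class u (\<lambda>n. Suc (N n))"
  let ?C = "internal_of u ?T (\<lambda>n. consumption f (\<kappa> n))" and ?K = "internal_of u ?T' \<kappa>"
  have path: "capital_path f (N n) (x n) (\<kappa> n)" for n
    using opt by (simp add: optimal_path_def)
  have feas: "feasible_plan u f ?T (hyper_class u x) ?C ?K"
    by (subst feasible_plan_iff[where c = "\<lambda>n. consumption f (\<kappa> n)" and k = \<kappa>])
      (use path in \<open>simp_all add: hyper_map_class represents_internal_of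
        internal_sequence_internal_of\<close>)
  have utility: "total_utility u U ?T ?C = hyper_class u (\<lambda>n. path_utility f U (N n) (\<kappa> n))"
    by (rule total_utility_consumption[OF represents_internal_of]) simp
  have "optimal_plan u f U ?T (hyper_class u x) ?C ?K"
    unfolding optimal_plan_def
  proof (intro conjI allI impI feas)
    fix C K assume "feasible_plan u f ?T (hyper_class u x) C K"
    then obtain c k where ck: "represents u ?T C c"
      "eventually (\<lambda>n. capital_path f (N n) (x n) (k n)) u"
      "eventually (\<lambda>n. \<forall>t\<le>N n. c n t = consumption f (k n) t) u"
      by (rule feasible_planE)
    show "hyper_le u (total_utility u U ?T C) (total_utility u U ?T ?C)"
      unfolding utility total_utility_consumption[OF ck(1,3)] hyper_le_class
      using ck(2) by (rule eventually_mono) (use opt in \<open>simp add: optimal_path_def\<close>)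
  qed
  moreover have "C = ?C \<and> K = ?K" if CK: "optimal_plan u f U ?T (hyper_class u x) C K" for C K
  proof -
    have CKf: "feasible_plan u f ?T (hyper_class u x) C K"
      using CK by (simp add: optimal_plan_def)
    then obtain c k where ck: "represents u ?T C c" "represents u ?T' K k"
      "eventually (\<lambda>n. capital_path f (N n) (x n) (k n)) u"
      "eventually (\<lambda>n. \<forall>t\<le>N n. c n t = consumption f (k n) t) u"
      by (rule feasible_planE)
    \<comment> \<open>An optimal plan does at least as well as the constructed one, which is
      feasible; read in the components, this is the premise of \<open>uniq\<close>.\<close>
    have "hyper_le u (total_utility u U ?T ?C) (total_utility u U ?T C)"
      using CK feas unfolding optimal_plan_def by blast
    then have "eventually (\<lambda>n. path_utility f U (N n) (\<kappa> n) \<le> path_utility f U (N n) (k n)) u"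
      by (simp add: utility total_utility_consumption[OF ck(1,4)] hyper_le_class)
    with ck(3) have k: "eventually (\<lambda>n. \<forall>t\<le>Suc (N n). k n t = \<kappa> n t) u"
      by eventually_elim (use uniq in blast)
    \<comment> \<open>Consumption at \<open>N n\<close> involves capital at
      \<open>Suc (N n)\<close>, so equality of capital is needed up to there.\<close>
    with ck(4) have c: "eventually (\<lambda>n. \<forall>t\<le>N n. c n t = consumption f (\<kappa> n) t) u"
      by eventually_elim (simp add: consumption_def)
    have "internal_sequence u ?T C" "internal_sequence u ?T' K"
      using CKf by (auto simp: feasible_plan_def hyper_map_class)
    then show ?thesis
      using internal_of_eqI[OF _ ck(1) c] internal_of_eqI[OF _ ck(2) k] by simp
  qed
  ultimately show ?thesis
    unfolding Ex1_def split_paired_Ex split_paired_All prod.case prod.inject by blast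
qed

(* f and U are functions on the nonnegative reals; their values at negative arguments are
   irrelevant. Continuity is on the closed half-line; continuous differentiability is only
   required at positive arguments, so an infinite slope at 0 is allowed. *)
theorem theorem1:
  fixes f U :: "real \<Rightarrow> real" and u :: "nat filter"
    and T :: "nat hyper" and K\<^sub>0 :: "real hyper"
  assumes "f \<in> {0..} \<rightarrow> {0..}"
    and "continuous_on {0..} f"
    and "strict_mono_on {0..} f"
    and "concave_on {0..} f"
    and "f C1_differentiable_on {0<..}"
    and "f 0 = 0"
    and "\<exists>x\<^sub>b>0. (\<forall>x\<in>{0..x\<^sub>b}. x \<le> f x \<and> f x \<le> x\<^sub>b) \<and> (\<forall>x>x\<^sub>b. f x < x)"
    and "continuous_on {0..} U"
    and "strict_mono_on {0..} U"
    and "strictly_concave_on {0..} U"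
    and "U C1_differentiable_on {0<..}"
    and "free_ultrafilter u"
    and "infinite_hypernatural u T"
    and "K\<^sub>0 \<in> hyperreals u"
    and "hyper_less u (hyper_of u 0) K\<^sub>0"
  shows "\<exists>!(C, K). optimal_plan u f U T K\<^sub>0 C K"
proof -
  obtain N where T: "T = hyper_class u N"
    using \<open>infinite_hypernatural u T\<close> by (auto simp: infinite_hypernatural_def hyper_carrier_def)
  obtain x\<^sub>0 where x\<^sub>0: "K\<^sub>0 = hyper_class u x\<^sub>0"
    using \<open>K\<^sub>0 \<in> hyperreals u\<close> by (auto simp: hyper_carrier_def)
  \<comment> \<open>The sign of \<open>K\<^sub>0\<close> controls only almost all components of a
    representative. Clamping at 0 keeps the class and makes every component a valid initial stock,
    so an optimal path can be chosen for each \<open>n\<close>.\<close>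
  define x where "x n = max 0 (x\<^sub>0 n)" for n
  have "eventually (\<lambda>n. 0 \<le> x\<^sub>0 n) u"
    using \<open>hyper_less u (hyper_of u 0) K\<^sub>0\<close>
    by (simp add: x\<^sub>0 hyper_less_def hyper_of_def hyper_le_class)
  then have K\<^sub>0: "K\<^sub>0 = hyper_class u x"
    unfolding x\<^sub>0 hyper_class_eq_iff x_def by eventually_elim simp
  have x: "0 \<le> x n" for n by (simp add: x_def)
  have "mono_on {0..} f"
    using \<open>strict_mono_on {0..} f\<close> by (rule strict_mono_on_imp_mono_on)
  then have "\<exists>k. optimal_path f U (N n) (x n) k" for n
    using assms by (intro optimal_path_exists x)
  then obtain \<kappa> where \<kappa>: "\<And>n. optimal_path f U (N n) (x n) (\<kappa> n)" by metis
  show ?thesis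
    unfolding T K\<^sub>0
    by (rule optimal_plan_unique_existence[OF \<kappa>])
      (use \<kappa> optimal_path_unique[OF x \<open>concave_on {0..} f\<close> \<open>strict_mono_on {0..} U\<close>
        \<open>strictly_concave_on {0..} U\<close>] in blast)
qed

end
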